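(* Let $T:[0,1]\to\mathbb{R}$ be the Takagi function and, for $y\in[0,\frac23]$, let $L(y)=\{x\in[0,1]:T(x)=y\}$. The set $S_\infty^{uc}:=\{y\in[0,\frac23]:L(y)\text{ is uncountably infinite}\}$ does not contain any dyadic rationals. In other words, if $y\in[0,\frac23]$ is a dyadic rational, then $L(y)$ is countable.
   Context: The Takagi function is $T(x)=\sum_{n=0}^\infty 2^{-n}\phi(2^n x)$, where $\phi(x)=\operatorname{dist}(x,\mathbb{Z})$; its range on $[0,1]$ is $[0,\frac23]$. "Countable" includes finite. *)

theory Defs
  imports "HOL-Analysis.Analysis"
begin

definition dist_int :: "real \<Rightarrow> real" where
  "dist_int x = infdist x \<int>"

(* Defined on all of the reals by the same series; the restriction of the
   domain to [0,1] is made in takagi_level. *)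
definition takagi :: "real \<Rightarrow> real" where
  "takagi x = (\<Sum>n. dist_int (2 ^ n * x) / 2 ^ n)"

definition takagi_level :: "real \<Rightarrow> real set" where
  "takagi_level y = {x \<in> {0..1}. takagi x = y}"

definition S_uc :: "real set" where
  "S_uc = {y \<in> {0..2/3}. uncountable (takagi_level y)}"

definition dyadic_rationals :: "real set" where
  "dyadic_rationals = {of_int k / 2 ^ m | (k :: int) (m :: nat). True}"

end

theory Submission
  imports Defs
begin

text \<open>
  For integers \<open>D\<close> and \<open>c\<close> consider the set \<open>A D c\<close> of all \<open>t \<in> [0,1]\<close> with
  \<open>T t + D * t = c\<close>. Halving the interval turns it into copies of \<open>A (D + 1) (2 * c)\<close> (left)
  and \<open>A (D - 1) (2 * c - 1 - D)\<close> (right), and after finitely many halvings a dyadic level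
  becomes an integer level. For \<open>D \<ge> 0\<close> the bound \<open>0 \<le> T < 1\<close> makes \<open>A D c\<close>
  finite unless \<open>0 < c \<le> D\<close>; hence, up to a finite set, a level set always sits inside just one
  of its two halves. Iterating, it sits up to a countable set inside arbitrarily short intervals,
  so it is countable. Negative \<open>D\<close> reduce to positive ones by \<open>T (1 - t) = T t\<close>.
\<close>

section \<open>An abstract countability criterion for almost nested sets\<close>

text \<open>Following \<open>step\<close> through \<open>n\<close> indices, each map halving
  distances, leaves diameter at most \<open>b / 2 ^ n\<close> outside a countable set. Discarding
  these exceptional sets for all \<open>n\<close> leaves at most one point.\<close>

lemma countable_if_almost_nested:
  fixes A :: "'i \<Rightarrow> 'a::metric_space set"
  assumes bound: "\<And>i x y. i \<in> I \<Longrightarrow> x \<in> A i \<Longrightarrow> y \<in> A i \<Longrightarrow> dist x y \<le> b"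
    and step: "\<And>i. i \<in> I \<Longrightarrow> \<exists>j\<in>I. \<exists>C f. countable C \<and> A i \<subseteq> C \<union> f ` A j \<and>
      (\<forall>x y. dist (f x) (f y) \<le> dist x y / 2)"
    and "i \<in> I"
  shows "countable (A i)"
proof -
  have ex: "\<exists>C. countable C \<and> (\<forall>x \<in> A i - C. \<forall>y \<in> A i - C. dist x y \<le> b / 2 ^ n)"
    if "i \<in> I" for i n
    using that
  proof (induction n arbitrary: i)
    case 0
    then show ?case using bound by (intro exI[of _ "{}"]) auto
  next
    case (Suc n)
    obtain j C f where j: "j \<in> I" and C: "countable C" "A i \<subseteq> C \<union> f ` A j"
      and f: "\<And>x y. dist (f x) (f y) \<le> dist x y / 2"
      using step[OF Suc.prems] by blast
    obtain C' where C': "countable C'"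
      "\<And>x y. x \<in> A j - C' \<Longrightarrow> y \<in> A j - C' \<Longrightarrow> dist x y \<le> b / 2 ^ n"
      using Suc.IH[OF j] by blast
    \<comment> \<open>The exceptional set for \<open>i\<close> is \<open>C\<close> together with the
      image of the one for \<open>j\<close>.\<close>
    have "dist x y \<le> b / 2 ^ Suc n"
      if xy: "x \<in> A i - (C \<union> f ` C')" "y \<in> A i - (C \<union> f ` C')" for x y
    proof -
      obtain u v where "u \<in> A j - C'" "v \<in> A j - C'" "x = f u" "y = f v"
        using xy C(2) by blast
      then have "dist x y \<le> dist u v / 2" "dist u v \<le> b / 2 ^ n"
        using C'(2) f by auto
      then show ?thesis by simp
    qed
    then show ?case using C(1) C'(1) by (intro exI[of _ "C \<union> f ` C'"]) auto
  qed
  obtain C where C: "\<And>n. countable (C n)"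
    "\<And>n x y. x \<in> A i - C n \<Longrightarrow> y \<in> A i - C n \<Longrightarrow> dist x y \<le> b / 2 ^ n"
    using ex[OF \<open>i \<in> I\<close>] by metis
  have "x = y" if "x \<in> A i - (\<Union>n. C n)" "y \<in> A i - (\<Union>n. C n)" for x y
  proof -
    have "dist x y \<le> b / 2 ^ n" for n
      using C(2) that by blast
    moreover have "(\<lambda>n. b / 2 ^ n) \<longlonglongrightarrow> 0"
      using tendsto_mult_right_zero[OF LIMSEQ_realpow_zero[of "1 / 2"], of b]
      by (simp add: power_divide)
    ultimately have "dist x y \<le> 0"
      by (intro LIMSEQ_le_const) auto
    then show ?thesis by simp
  qed
  then have "countable (A i - (\<Union>n. C n))"
    by (metis (no_types) countable_empty countable_insert countable_subset insertCI subsetI subset_empty equals0I)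
  moreover have "countable (\<Union>n. C n)" using C(1) by auto
  ultimately show ?thesis
    by (metis Diff_subset Un_Diff_cancel2 countable_Un countable_subset sup_ge1)
qed

section \<open>Distance to the nearest integer\<close>

lemma dist_int_nonneg: "0 \<le> dist_int x"
  by (simp add: dist_int_def infdist_nonneg)

lemma dist_int_le: "dist_int x \<le> \<bar>x - of_int k\<bar>"
  unfolding dist_int_def using infdist_le[of "of_int k" \<int> x] by (simp add: dist_real_def)

lemma dist_int_le_half: "dist_int x \<le> 1 / 2"
  using dist_int_le[of x "round x"] of_int_round_abs_le[of x] by (simp add: abs_minus_commute)

lemma dist_int_ge:
  assumes "\<And>k::int. d \<le> \<bar>x - of_int k\<bar>"
  shows "d \<le> dist_int x"
proof -
  have "(\<int> :: real set) \<noteq> {}" by (metis Ints_0 empty_iff)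
  then show ?thesis
    unfolding dist_int_def infdist_def using assms
    by (auto intro!: cINF_greatest simp: dist_real_def elim!: Ints_cases)
qed

lemma dist_int_left: "0 \<le> x \<Longrightarrow> x \<le> 1 / 2 \<Longrightarrow> dist_int x = x"
proof (rule antisym)
  assume x: "0 \<le> x" "x \<le> 1 / 2"
  show "dist_int x \<le> x" using dist_int_le[of x 0] x by simp
  show "x \<le> dist_int x"
  proof (rule dist_int_ge)
    fix k :: int
    show "x \<le> \<bar>x - of_int k\<bar>"
    proof (cases "k \<le> 0")
      case False
      then have "1 \<le> real_of_int k" by simp
      then show ?thesis using x by linarith
    qed (use x in auto)
  qed
qed

lemma dist_int_add_int: "dist_int (x + of_int m) = dist_int x"
proof (rule antisym; rule dist_int_ge)
  fix k :: int
  show "dist_int (x + of_int m) \<le> \<bar>x - of_int k\<bar>"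
    using dist_int_le[of "x + of_int m" "k + m"] by simp
  show "dist_int x \<le> \<bar>x + of_int m - of_int k\<bar>"
    using dist_int_le[of x "k - m"] by (simp add: algebra_simps)
qed

lemma dist_int_minus: "dist_int (- x) = dist_int x"
proof (rule antisym; rule dist_int_ge)
  fix k :: int
  show "dist_int (- x) \<le> \<bar>x - of_int k\<bar>"
    using dist_int_le[of "- x" "- k"] by simp
  show "dist_int x \<le> \<bar>- x - of_int k\<bar>"
    using dist_int_le[of x "- k"] by simp
qed

lemma dist_int_right: "1 / 2 \<le> x \<Longrightarrow> x \<le> 1 \<Longrightarrow> dist_int x = 1 - x"
  using dist_int_left[of "1 - x"] dist_int_minus[of "1 - x"] dist_int_add_int[of "x - 1" 1] by simp

section \<open>Bounds and functional equations of the Takagi function\<close>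

lemma takagi_sums: "(\<lambda>n. dist_int (2 ^ n * x) / 2 ^ n) sums takagi x"
  and takagi_le_1: "takagi x \<le> 1"
proof -
  \<comment> \<open>This majorant, from \<open>dist_int_le_half\<close>, gives both the convergence
    and the upper bound.\<close>
  have geo: "(\<lambda>n. 1 / 2 * (1 / 2) ^ n :: real) sums 1"
    using sums_mult[OF geometric_sums[of "1 / 2 :: real"], of "1 / 2"] by simp
  have le: "dist_int (2 ^ n * x) / 2 ^ n \<le> 1 / 2 * (1 / 2) ^ n" for n
    using dist_int_le_half[of "2 ^ n * x"] by (simp add: field_simps)
  have "summable (\<lambda>n. dist_int (2 ^ n * x) / 2 ^ n)"
    by (rule summable_comparison_test'[OF sums_summable[OF geo], of 0])
      (use le dist_int_nonneg in auto)
  then show sums: "(\<lambda>n. dist_int (2 ^ n * x) / 2 ^ n) sums takagi x"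
    unfolding takagi_def by (rule summable_sums)
  show "takagi x \<le> 1"
    using sums_le[OF le sums geo] .
qed

lemma takagi_nonneg: "0 \<le> takagi x"
  by (rule sums_le[OF _ sums_zero takagi_sums]) (simp add: dist_int_nonneg)

text \<open>Self-similarity: the series without its zeroth term is half the series at
  \<open>2 * x\<close>.\<close>

lemma takagi_double: "takagi x = dist_int x + takagi (2 * x) / 2"
proof -
  have "(\<lambda>n. dist_int (2 ^ Suc n * x) / 2 ^ Suc n) sums (takagi (2 * x) / 2)"
    using sums_divide[OF takagi_sums[of "2 * x"], of 2] by (simp add: mult_ac)
  then have "(\<lambda>n. dist_int (2 ^ n * x) / 2 ^ n) sums (takagi (2 * x) / 2 + dist_int x)"
    by (subst (asm) sums_Suc_iff) simp
  then show ?thesis using takagi_sums sums_unique2 by fastforce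
qed

lemma takagi_minus: "takagi (- x) = takagi x"
  by (simp add: takagi_def dist_int_minus)

lemma takagi_add_int: "takagi (x + of_int m) = takagi x"
proof -
  have "dist_int (2 ^ n * (x + of_int m)) = dist_int (2 ^ n * x)" for n
    using dist_int_add_int[of "2 ^ n * x" "2 ^ n * m"] by (simp add: algebra_simps)
  then show ?thesis by (simp add: takagi_def)
qed

lemma takagi_symmetric: "takagi (1 - x) = takagi x"
  using takagi_add_int[of "- x" 1] by (simp add: takagi_minus)

lemma takagi_left: "0 \<le> x \<Longrightarrow> x \<le> 1 / 2 \<Longrightarrow> takagi x = x + takagi (2 * x) / 2"
  using takagi_double[of x] by (simp add: dist_int_left)

lemma takagi_right: "1 / 2 \<le> x \<Longrightarrow> x \<le> 1 \<Longrightarrow> takagi x = 1 - x + takagi (2 * x - 1) / 2"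
  using takagi_double[of x] takagi_add_int[of "2 * x" "- 1"] by (simp add: dist_int_right)

lemma takagi_less_1:
  assumes "0 \<le> x" "x \<le> 1"
  shows "takagi x < 1"
proof -
  have "takagi x = dist_int x + dist_int (2 * x) / 2 + takagi (4 * x) / 4"
    using takagi_double[of x] takagi_double[of "2 * x"] by (simp add: field_simps)
  \<comment> \<open>On each half of the interval the slope of \<open>dist_int x\<close> cancels
    against that of \<open>\<bar>2 * x - 1\<bar> / 2\<close>. The tail adds at most
    \<open>1 / 4\<close>, so strictness follows.\<close>
  moreover have "dist_int x + dist_int (2 * x) / 2 \<le> 1 / 2"
    using dist_int_le[of "2 * x" 1] dist_int_left[of x] dist_int_right[of x] assms
    by (cases "x \<le> 1 / 2") (auto simp: field_simps)
  ultimately show ?thesis using takagi_le_1[of "4 * x"] by linarith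
qed

lemma takagi_pos:
  assumes "0 < x" "x < 1"
  shows "0 < takagi x"
proof -
  have "0 < dist_int x"
    using dist_int_left[of x] dist_int_right[of x] assms by (cases "x \<le> 1 / 2") auto
  then show ?thesis using takagi_double[of x] takagi_nonneg[of "2 * x"] by linarith
qed

section \<open>Tilted level sets at integer levels\<close>

text \<open>These are the sets \<open>A D c\<close> above, for any real level. The linear term
  absorbs the slopes 1 and -1 that \<open>takagi_left\<close> and \<open>takagi_right\<close>
  contribute, so the family is stable under halving.\<close>

definition tilted_level :: "int \<Rightarrow> real \<Rightarrow> real set" where
  "tilted_level D y = {t \<in> {0..1}. takagi t + of_int D * t = y}"

lemma tilted_level_halves:
  "tilted_level D y \<subseteq>
    (\<lambda>s. s / 2) ` tilted_level (D + 1) (2 * y) \<union>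
    (\<lambda>s. (1 + s) / 2) ` tilted_level (D - 1) (2 * y - 1 - of_int D)"
proof
  fix t assume t: "t \<in> tilted_level D y"
  show "t \<in> (\<lambda>s. s / 2) ` tilted_level (D + 1) (2 * y) \<union>
    (\<lambda>s. (1 + s) / 2) ` tilted_level (D - 1) (2 * y - 1 - of_int D)"
  proof (cases "t \<le> 1 / 2")
    case True
    then have "2 * t \<in> tilted_level (D + 1) (2 * y)"
      using t takagi_left[of t] by (auto simp: tilted_level_def algebra_simps)
    then show ?thesis by (intro UnI1 image_eqI[of _ _ "2 * t"]) auto
  next
    case False
    then have "2 * t - 1 \<in> tilted_level (D - 1) (2 * y - 1 - of_int D)"
      using t takagi_right[of t] by (auto simp: tilted_level_def algebra_simps)
    then show ?thesis by (intro UnI2 image_eqI[of _ _ "2 * t - 1"]) auto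
  qed
qed

lemma tilted_level_nonpos:
  assumes "0 \<le> D" "y \<le> 0"
  shows "tilted_level D y \<subseteq> {0, 1}"
proof
  fix t assume "t \<in> tilted_level D y"
  then have t: "0 \<le> t" "t \<le> 1" "takagi t + of_int D * t = y" by (auto simp: tilted_level_def)
  have "0 \<le> of_int D * t" using assms t by simp
  then have "takagi t \<le> 0" using t assms by linarith
  then have "\<not> (0 < t \<and> t < 1)" using takagi_pos[of t] by linarith
  then show "t \<in> {0, 1}" using t by auto
qed

text \<open>The strict bound \<open>takagi_less_1\<close> is what admits equality in the hypothesis;
  equality does occur when the left half is discarded below.\<close>

lemma tilted_level_large:
  assumes "0 \<le> D" "of_int D + 1 \<le> y"
  shows "tilted_level D y = {}"
proof -
  have False if "t \<in> tilted_level D y" for t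
  proof -
    have t: "0 \<le> t" "t \<le> 1" "takagi t + of_int D * t = y"
      using that by (auto simp: tilted_level_def)
    have "of_int D * t \<le> of_int D" using assms(1) t by (simp add: mult_left_le)
    then show False using takagi_less_1[of t] t assms(2) by linarith
  qed
  then show ?thesis by blast
qed

lemma countable_tilted_level_nonneg:
  assumes "0 \<le> D"
  shows "countable (tilted_level D (of_int c))"
proof -
  let ?A = "\<lambda>(D, c). tilted_level D (of_int c)"
  let ?I = "{0::int..} \<times> (UNIV :: int set)"
  have "countable (?A (D, c))"
  proof (rule countable_if_almost_nested[where I = ?I and b = 1])
    fix i x y assume "i \<in> ?I" "x \<in> ?A i" "y \<in> ?A i"
    then show "dist x y \<le> 1"
      by (auto simp: tilted_level_def dist_real_def)
  next
    fix i assume "i \<in> ?I"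
    then obtain D c where i: "i = (D, c)" and D: "0 \<le> D" by auto
    have contract: "dist (x / 2) (y / 2) \<le> dist x y / 2"
      "dist ((1 + x) / 2) ((1 + y) / 2) \<le> dist x y / 2" for x y :: real
      by (auto simp: dist_real_def abs_if field_simps)
    \<comment> \<open>In the last two cases \<open>D\<close> is at least 1, so both halves have
      nonnegative slope. Comparing \<open>2 * c\<close> with \<open>D + 1\<close> decides which half
      is negligible.\<close>
    consider "c \<le> 0" | "D < c" | "0 < c" "c \<le> D" "2 * c \<le> D + 1" | "0 < c" "c \<le> D" "D + 1 < 2 * c"
      by linarith
    then obtain D' c' C f where "0 \<le> D'" "countable C"
      "tilted_level D (of_int c) \<subseteq> C \<union> f ` tilted_level D' (of_int c')"
      "\<forall>x y. dist (f x) (f y) \<le> dist x y / 2"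
    proof cases
      case 1
      \<comment> \<open>The countable part \<open>{0, 1}\<close> already covers the set; the map and
        the target pair are arbitrary.\<close>
      then show thesis using tilted_level_nonpos[OF D, of "of_int c"]
        by (intro that[of D "{0, 1}" "\<lambda>s. s / 2" c] D allI contract) auto
    next
      case 2
      then have "tilted_level D (of_int c) = {}" by (intro tilted_level_large D) linarith
      then show thesis
        by (intro that[of D "{}" "\<lambda>s. s / 2" c] D allI contract) auto
    next
      case 3
      \<comment> \<open>The right half has level at most 0, hence at most two points; the left half
        is kept.\<close>
      then have "real_of_int (2 * c) \<le> of_int (D + 1)" by (subst of_int_le_iff)
      then have "countable (tilted_level (D - 1) (2 * of_int c - 1 - of_int D))"
        using 3 by (intro countable_subset[OF tilted_level_nonpos]) auto
      then show thesis using tilted_level_halves[of D "of_int c"] D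
        by (intro that[of "D + 1"
              "(\<lambda>s. (1 + s) / 2) ` tilted_level (D - 1) (2 * of_int c - 1 - of_int D)"
              "\<lambda>s. s / 2" "2 * c"] allI contract) auto
    next
      case 4
      \<comment> \<open>Integrality turns the strict inequality into exactly the threshold that
        empties the left half, of slope \<open>D + 1\<close>; the right half is kept.\<close>
      then have "real_of_int (D + 2) \<le> of_int (2 * c)" by (subst of_int_le_iff) simp
      then have "tilted_level (D + 1) (2 * of_int c) = {}"
        using D by (intro tilted_level_large) auto
      then show thesis using tilted_level_halves[of D "of_int c"] 4
        by (intro that[of "D - 1" "{}" "\<lambda>s. (1 + s) / 2" "2 * c - 1 - D"] allI contract) auto
    qed
    then show "\<exists>j\<in>?I. \<exists>C f. countable C \<and> ?A i \<subseteq> C \<union> f ` ?A j \<and>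
        (\<forall>x y. dist (f x) (f y) \<le> dist x y / 2)"
      by (intro bexI[of _ "(D', c')"] exI[of _ C] exI[of _ f]) (auto simp: i)
  qed (use assms in auto)
  then show ?thesis by simp
qed

section \<open>Negative slopes and dyadic levels\<close>

text \<open>By \<open>takagi_symmetric\<close>, replacing \<open>t\<close> by \<open>1 - t\<close>
  flips the sign of the slope and shifts the level by an integer.\<close>

lemma tilted_level_reflect:
  "tilted_level D y = (\<lambda>t. 1 - t) ` tilted_level (- D) (y - of_int D)"
proof -
  have reflect: "1 - t \<in> tilted_level (- D) (y - of_int D)" if "t \<in> tilted_level D y" for t D y
    using that by (auto simp: tilted_level_def takagi_symmetric algebra_simps)
  show ?thesis
    using reflect[of _ D y] reflect[of _ "- D" "y - of_int D"] by (force simp: image_iff)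
qed

lemma countable_tilted_level_int: "countable (tilted_level D (of_int c))"
proof (cases "0 \<le> D")
  case False
  then have "countable (tilted_level (- D) (of_int (c - D)))"
    by (intro countable_tilted_level_nonneg) simp
  then show ?thesis by (subst tilted_level_reflect) simp
qed (rule countable_tilted_level_nonneg)

text \<open>Each halving doubles the level up to an integer shift, lowering the exponent of the
  denominator by one. The slope changes too, so the induction runs over all \<open>D\<close> and
  \<open>c\<close>.\<close>

lemma countable_tilted_level_dyadic: "countable (tilted_level D (of_int c / 2 ^ n))"
proof (induction n arbitrary: D c)
  case 0
  then show ?case using countable_tilted_level_int by simp
next
  case (Suc n)
  have "countable (tilted_level (D + 1) (2 * (of_int c / 2 ^ Suc n)))"
    using Suc[of "D + 1" c] by simp
  moreover have "countable (tilted_level (D - 1) (2 * (of_int c / 2 ^ Suc n) - 1 - of_int D))"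
    \<comment> \<open>The numerator of the right half's level over the denominator
      \<open>2 ^ n\<close>.\<close>
    using Suc[of "D - 1" "c - (1 + D) * 2 ^ n"] by (simp add: field_simps)
  ultimately show ?case
    by (intro countable_subset[OF tilted_level_halves]) auto
qed

lemma countable_takagi_level:
  assumes "y \<in> dyadic_rationals"
  shows "countable (takagi_level y)"
proof -
  have "takagi_level y = tilted_level 0 y"
    by (auto simp: takagi_level_def tilted_level_def)
  then show ?thesis
    using assms countable_tilted_level_dyadic by (auto simp: dyadic_rationals_def)
qed

theorem proposition4p5:
  shows "S_uc \<inter> dyadic_rationals = {}
    \<and> (\<forall>y \<in> {0..2/3}. y \<in> dyadic_rationals \<longrightarrow> countable (takagi_level y))"
  using countable_takagi_level by (auto simp: S_uc_def)

end
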